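(* Let $n\ge 1$ and let $\{b^x_k\}_{k=1}^{n}$, for $x\in\{0,\dots,n\}$, be $n+1$ pairwise mutually unbiased orthonormal bases of $\mathbb{C}^n$ (i.e. $|\langle b^x_k|b^y_l\rangle|^2=1/n$ for $x\neq y$). For $f:\{0,\dots,n\}\to\{1,\dots,n\}$ let $$|\mu_f\rangle := \frac{1}{\sqrt{n}}\Big(\sum_{x=0}^{n} \overline{b^x_{f(x)}}\otimes b^x_{f(x)} - \sum_{k=1}^{n} e_k\otimes e_k\Big)\in\mathbb{C}^n\otimes\mathbb{C}^n.$$ Let $f_1,\dots,f_{n^2}:\{0,\dots,n\}\to\{1,\dots,n\}$ be functions such that $\{|\mu_{f_i}\rangle\}_{i=1}^{n^2}$ is an orthonormal basis of $\mathbb{C}^n\otimes\mathbb{C}^n$. Then the following Mean King scheme solves the Mean King problem: Alice's bipartite measurement $\mu$ is the projective measurement in the basis $\{|\mu_{f_i}\rangle\}_i$, and her classical look-up function is $f(i,x) := f_i(x)$. That is, suppose Alice prepares $\frac{1}{\sqrt n}\sum_{k} e_k\otimes e_k$ and sends the second tensor factor to the King; the King chooses $x\in\{0,\dots,n\}$, measures his system projectively in the basis $\{b^x_k\}_k$, obtaining outcome $a$, and returns the post-measurement system; Alice measures both systems in the basis $\{|\mu_{f_i}\rangle\}_i$, obtaining outcome $i$; then with probability one (for every choice of $x$) $f_i(x) = a$, i.e. Alice's output $f(i,x)$ equals the King's measurement outcome.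
   Context: $(e_k)$ is the standard basis of $\mathbb{C}^n$ and $\overline{v}$ denotes entrywise complex conjugation in that basis. The Mean King problem: Alice hands a quantum system to the King; the King measures it in one of the given mutually unbiased bases, keeping basis and outcome secret, and returns it; Alice performs any quantum measurement; the King then reveals his basis; Alice must determine the King's outcome using only classical processing. A Mean King scheme consists of the family of bases, a bipartite measurement $\mu$ for Alice on her retained system together with the returned system, and a classical function $f$ from (Alice's outcome, King's basis) to a guessed outcome; it solves the problem if Alice's guess always coincides with the King's outcome. *)

theory Defs
  imports "HOL-Probability.Probability"
begin

definition cinner :: "complex ^ 'm::finite \<Rightarrow> complex ^ 'm \<Rightarrow> complex" where
  "cinner u v = (\<Sum>i\<in>UNIV. cnj (u $ i) * v $ i)"

definition conj_vec :: "complex ^ 'm::finite \<Rightarrow> complex ^ 'm" where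
  "conj_vec v = (\<chi> i. cnj (v $ i))"

text \<open>The tensor product of \<open>\<complex>\<^sup>A\<close> and \<open>\<complex>\<^sup>B\<close> is taken to be \<open>\<complex>\<close> to the power \<open>A \<times> B\<close>, where the
  coordinate \<open>(i, j)\<close> belongs to the basis vector \<open>e\<^sub>i \<otimes> e\<^sub>j\<close>.\<close>

definition tensor_vec ::
  "complex ^ 'a::finite \<Rightarrow> complex ^ 'b::finite \<Rightarrow> complex ^ ('a \<times> 'b)" where
  "tensor_vec u v = (\<chi> p. u $ fst p * v $ snd p)"

definition tensor_mat ::
  "complex ^ 'a::finite ^ 'a \<Rightarrow> complex ^ 'b::finite ^ 'b \<Rightarrow> complex ^ ('a \<times> 'b) ^ ('a \<times> 'b)" where
  "tensor_mat A B = (\<chi> p q. A $ fst p $ fst q * B $ snd p $ snd q)"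

text \<open>The rank-one operator \<open>|v\<rangle>\<langle>v|\<close>.\<close>

definition proj_vec :: "complex ^ 'm::finite \<Rightarrow> complex ^ 'm ^ 'm" where
  "proj_vec v = (\<chi> i j. v $ i * cnj (v $ j))"

definition orthonormal_basis :: "'i set \<Rightarrow> ('i \<Rightarrow> complex ^ 'm::finite) \<Rightarrow> bool" where
  "orthonormal_basis I v \<longleftrightarrow>
     (\<forall>i\<in>I. \<forall>j\<in>I. cinner (v i) (v j) = (if i = j then 1 else 0)) \<and>
     vec.span (v ` I) = UNIV"

definition mutually_unbiased_bases :: "'x set \<Rightarrow> ('x \<Rightarrow> 'n \<Rightarrow> complex ^ 'n::finite) \<Rightarrow> bool" where
  "mutually_unbiased_bases X b \<longleftrightarrow>
     (\<forall>x\<in>X. orthonormal_basis UNIV (b x)) \<and>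
     (\<forall>x\<in>X. \<forall>y\<in>X. x \<noteq> y \<longrightarrow>
        (\<forall>k l. (cmod (cinner (b x k) (b y l)))\<^sup>2 = 1 / real CARD('n)))"

text \<open>A general quantum measurement (POVM) with outcome set \<open>I\<close>.\<close>

definition quantum_measurement :: "'i set \<Rightarrow> ('i \<Rightarrow> complex ^ 'm::finite ^ 'm) \<Rightarrow> bool" where
  "quantum_measurement I E \<longleftrightarrow>
     finite I \<and>
     (\<forall>i\<in>I. \<forall>v. cinner v (E i *v v) \<in> \<real>\<^sub>\<ge>\<^sub>0) \<and>
     (\<Sum>i\<in>I. E i) = mat 1"

definition born_prob :: "complex ^ 'm::finite ^ 'm \<Rightarrow> complex ^ 'm \<Rightarrow> real" where
  "born_prob E \<psi> = Re (cinner \<psi> (E *v \<psi>))"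

text \<open>The state after a projective measurement whose outcome has projector \<open>P\<close>. It is the zero vector
  if that outcome has probability zero.\<close>

definition post_state :: "complex ^ 'm::finite ^ 'm \<Rightarrow> complex ^ 'm \<Rightarrow> complex ^ 'm" where
  "post_state P \<psi> = (1 / norm (P *v \<psi>)) *\<^sub>R (P *v \<psi>)"

text \<open>Alice keeps the first tensor factor; the King measures the second one in the basis
  \<open>c\<close> and gets \<open>a\<close>.\<close>

definition king_proj :: "('n \<Rightarrow> complex ^ 'n::finite) \<Rightarrow> 'n \<Rightarrow> complex ^ ('a::finite \<times> 'n) ^ ('a \<times> 'n)" where
  "king_proj c a = tensor_mat (mat 1) (proj_vec (c a))"

text \<open>The joint distribution of the King's outcome \<open>a\<close> and Alice's outcome \<open>i\<close>, if Alice prepares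
  \<open>\<psi>\<close>, the King measures in the basis \<open>c\<close>, and Alice then performs the measurement \<open>E\<close> on both
  systems.\<close>

definition mean_king_experiment ::
  "complex ^ ('a::finite \<times> 'n::finite) \<Rightarrow> ('n \<Rightarrow> complex ^ 'n) \<Rightarrow> 'i set \<Rightarrow>
   ('i \<Rightarrow> complex ^ ('a \<times> 'n) ^ ('a \<times> 'n)) \<Rightarrow> ('n \<times> 'i) measure" where
  "mean_king_experiment \<psi> c I E =
     point_measure (UNIV \<times> I)
       (\<lambda>(a, i). ennreal (born_prob (king_proj c a) \<psi> *
                          born_prob (E i) (post_state (king_proj c a) \<psi>)))"

definition mean_king_scheme ::
  "'x set \<Rightarrow> ('x \<Rightarrow> 'n \<Rightarrow> complex ^ 'n) \<Rightarrow> complex ^ ('a::finite \<times> 'n::finite) \<Rightarrow> 'i set \<Rightarrow>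
   ('i \<Rightarrow> complex ^ ('a \<times> 'n) ^ ('a \<times> 'n)) \<Rightarrow> ('i \<Rightarrow> 'x \<Rightarrow> 'n) \<Rightarrow> bool" where
  "mean_king_scheme X b \<psi> I E g \<longleftrightarrow>
     mutually_unbiased_bases X b \<and> norm \<psi> = 1 \<and> quantum_measurement I E"

definition solves_mean_king ::
  "'x set \<Rightarrow> ('x \<Rightarrow> 'n \<Rightarrow> complex ^ 'n) \<Rightarrow> complex ^ ('a::finite \<times> 'n::finite) \<Rightarrow> 'i set \<Rightarrow>
   ('i \<Rightarrow> complex ^ ('a \<times> 'n) ^ ('a \<times> 'n)) \<Rightarrow> ('i \<Rightarrow> 'x \<Rightarrow> 'n) \<Rightarrow> bool" where
  "solves_mean_king X b \<psi> I E g \<longleftrightarrow>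
     (\<forall>x\<in>X. prob_space (mean_king_experiment \<psi> (b x) I E) \<and>
             (AE (a, i) in mean_king_experiment \<psi> (b x) I E. g i x = a))"

definition max_entangled :: "complex ^ ('n::finite \<times> 'n)" where
  "max_entangled =
     (1 / sqrt (real CARD('n))) *\<^sub>R (\<Sum>k\<in>UNIV. tensor_vec (axis k 1) (axis k 1))"

definition mu_vec ::
  "(nat \<Rightarrow> 'n \<Rightarrow> complex ^ 'n::finite) \<Rightarrow> (nat \<Rightarrow> 'n) \<Rightarrow> complex ^ ('n \<times> 'n)" where
  "mu_vec b f =
     (1 / sqrt (real CARD('n))) *\<^sub>R
       ((\<Sum>x = 0..CARD('n). tensor_vec (conj_vec (b x (f x))) (b x (f x)))
        - (\<Sum>k\<in>UNIV. tensor_vec (axis k 1) (axis k 1)))"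

end

theory Submission
  imports Defs
begin

text \<open>
  For a unit vector \<open>u\<close> write \<open>\<phi>\<^sub>u\<close> for \<open>conj u \<otimes> u\<close>. If the King obtains \<open>a\<close> in the basis \<open>b x\<close>, the
  maximally entangled state collapses to \<open>\<phi>\<^sub>u\<close> with \<open>u = b x a\<close>, and this happens with
  probability \<open>1/n\<close>. Since \<open>\<langle>\<phi>\<^sub>u|\<phi>\<^sub>v\<rangle> = |\<langle>u|v\<rangle>|\<^sup>2\<close>, unbiasedness gives
  \<open>\<surd>n \<langle>\<mu>\<^sub>f|\<phi>\<^sub>u\<rangle> = \<delta> + n \<cdot> 1/n - 1 = \<delta>\<close>, where \<open>\<delta>\<close> is \<open>1\<close> if \<open>f x = a\<close> and \<open>0\<close> otherwise: the \<open>n\<close> bases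
  other than \<open>b x\<close> contribute \<open>1/n\<close> each, and the subtracted \<open>\<Sum>\<^sub>k e\<^sub>k \<otimes> e\<^sub>k\<close> cancels them. Hence Alice
  never sees an outcome \<open>i\<close> with \<open>f\<^sub>i x \<noteq> a\<close>.
\<close>

lemma cinner_add_left: "cinner (u + v) w = cinner u w + cinner v w"
  by (simp add: cinner_def sum.distrib algebra_simps)

lemma cinner_diff_left: "cinner (u - v) w = cinner u w - cinner v w"
  by (simp add: cinner_def sum_subtractf algebra_simps)

lemma cinner_scaleR_left: "cinner (r *\<^sub>R u) w = of_real r * cinner u w"
  unfolding cinner_def vector_scaleR_component
  by (simp add: sum_distrib_left algebra_simps scaleR_conv_of_real)

lemma cinner_sum_left: "cinner (\<Sum>i\<in>I. u i) w = (\<Sum>i\<in>I. cinner (u i) w)"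
proof (induction I rule: infinite_finite_induct)
  case (insert i I)
  then show ?case by (simp add: cinner_add_left)
qed (simp_all add: cinner_def)

lemma cinner_add_right: "cinner u (v + w) = cinner u v + cinner u w"
  by (simp add: cinner_def sum.distrib algebra_simps)

lemma cinner_scaleR_right: "cinner u (r *\<^sub>R v) = of_real r * cinner u v"
  unfolding cinner_def vector_scaleR_component
  by (simp add: sum_distrib_left algebra_simps scaleR_conv_of_real)

lemma cinner_smult_right: "cinner u (c *s v) = c * cinner u v"
  by (simp add: cinner_def sum_distrib_left algebra_simps)

lemma cnj_cinner: "cnj (cinner u v) = cinner v u"
  by (simp add: cinner_def mult.commute)

lemma cinner_self: "cinner v v = of_real ((norm v)\<^sup>2)"
proof -
  have "(norm v)\<^sup>2 = (\<Sum>i\<in>UNIV. (cmod (v $ i))\<^sup>2)"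
    by (simp add: norm_vec_def L2_set_def sum_nonneg)
  then show ?thesis
    by (simp only: cinner_def of_real_sum complex_norm_square mult.commute)
qed

lemma norm_eq_1_if_cinner: "cinner v v = 1 \<Longrightarrow> norm v = 1"
  by (metis cinner_self norm_ge_zero of_real_eq_1_iff power2_eq_1_iff
      zero_le_one not_one_le_zero neg_0_le_iff_le dual_order.trans)

lemma proj_vec_mult: "proj_vec w *v v = cinner w v *s w"
  by (simp add: vec_eq_iff proj_vec_def matrix_vector_mult_def cinner_def sum_distrib_left
      algebra_simps)

lemma cinner_proj_vec: "cinner v (proj_vec w *v v) = of_real ((cmod (cinner w v))\<^sup>2)"
  unfolding proj_vec_mult cinner_smult_right complex_norm_square cnj_cinner ..

lemma born_prob_proj_vec: "born_prob (proj_vec w) v = (cmod (cinner w v))\<^sup>2"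
  by (simp add: born_prob_def cinner_proj_vec)

text \<open>Both sides are linear in \<open>v\<close>, so induction over the span reduces the claim
  to a basis vector, where orthonormality leaves a single term.\<close>

lemma orthonormal_basis_expansion:
  assumes "orthonormal_basis I w" and "finite I"
  shows "(\<Sum>i\<in>I. cinner (w i) v *s w i) = v"
proof -
  have orth: "cinner (w i) (w j) = (if i = j then 1 else 0)" if "i \<in> I" "j \<in> I" for i j
    using assms(1) that by (simp add: orthonormal_basis_def)
  have "v \<in> vec.span (w ` I)"
    using assms(1) by (simp add: orthonormal_basis_def)
  then show ?thesis
  proof (induction rule: vec.span_induct_alt)
    case base
    then show ?case by (simp add: cinner_def)
  next
    case (step c x y)
    then obtain j where j: "j \<in> I" "x = w j" by blast
    have "(\<Sum>i\<in>I. cinner (w i) (w j) *s w i) = (\<Sum>i\<in>I. if i = j then w i else 0)"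
      using orth j by (intro sum.cong) auto
    also have "\<dots> = w j"
      using j assms(2) by simp
    finally have "(\<Sum>i\<in>I. cinner (w i) x *s w i) = x"
      using j by simp
    moreover have "(\<Sum>i\<in>I. cinner (w i) (c *s x + y) *s w i) =
        c *s (\<Sum>i\<in>I. cinner (w i) x *s w i) + (\<Sum>i\<in>I. cinner (w i) y *s w i)"
      by (simp add: cinner_add_right cinner_smult_right vec.scale_left_distrib sum.distrib
          vec.scale_sum_right)
    ultimately show ?case using step by simp
  qed
qed

text \<open>Completeness is the basis expansion read as an operator identity; positivity holds
  because each expectation value is a squared modulus.\<close>

lemma quantum_measurement_orthonormal_basis:
  assumes "orthonormal_basis I w" and "finite I"
  shows "quantum_measurement I (\<lambda>i. proj_vec (w i))"
proof -
  have mult: "(\<Sum>i\<in>I. A i) *v v = (\<Sum>i\<in>I. A i *v v)" for A :: "'a \<Rightarrow> complex ^ 'b ^ 'b" and v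
    using assms(2) by (induction I rule: finite_induct) (auto simp: matrix_vector_mult_add_rdistrib)
  have "(\<Sum>i\<in>I. proj_vec (w i)) = mat 1"
    unfolding matrix_eq mult proj_vec_mult
    using orthonormal_basis_expansion[OF assms] by simp
  then show ?thesis
    using assms(2) by (simp add: quantum_measurement_def cinner_proj_vec)
qed

lemma cinner_tensor_vec: "cinner (tensor_vec u v) (tensor_vec u' v') = cinner u u' * cinner v v'"
proof -
  have "cinner (tensor_vec u v) (tensor_vec u' v') =
      (\<Sum>(i, j)\<in>UNIV \<times> UNIV. (cnj (u $ i) * u' $ i) * (cnj (v $ j) * v' $ j))"
    by (simp add: cinner_def tensor_vec_def case_prod_unfold algebra_simps)
  also have "\<dots> = cinner u u' * cinner v v'"
    by (simp add: cinner_def sum_product sum.cartesian_product)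
  finally show ?thesis .
qed

lemma cinner_conj_vec: "cinner (conj_vec u) (conj_vec v) = cinner v u"
  by (simp add: cinner_def conj_vec_def mult.commute)

text \<open>The conjugated factor contributes the complex conjugate of \<open>cinner u v\<close>, so
  phases cancel and only the overlap that unbiasedness controls remains.\<close>

lemma cinner_conj_tensor:
  "cinner (tensor_vec (conj_vec u) u) (tensor_vec (conj_vec v) v) =
     of_real ((cmod (cinner u v))\<^sup>2)"
  unfolding cinner_tensor_vec cinner_conj_vec complex_norm_square cnj_cinner
  by (simp add: mult.commute)

lemma cinner_axis: "cinner (axis k 1) v = v $ k"
proof -
  have "cinner (axis k 1) v = (\<Sum>i\<in>UNIV. if i = k then v $ i else 0)"
    unfolding cinner_def by (intro sum.cong) (auto simp: axis_def)
  then show ?thesis by simp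
qed

lemma cinner_diagonal_conj_tensor:
  "cinner (\<Sum>k\<in>UNIV. tensor_vec (axis k 1) (axis k 1)) (tensor_vec (conj_vec v) v) = cinner v v"
  unfolding cinner_sum_left cinner_tensor_vec cinner_axis
  by (simp add: cinner_def conj_vec_def)

lemma diagonal_tensor_nth:
  "(\<Sum>k\<in>UNIV. tensor_vec (axis k 1) (axis k 1)) $ p = (if fst p = snd p then 1 else 0)"
proof -
  have "(\<Sum>k\<in>UNIV. tensor_vec (axis k 1) (axis k 1)) $ p =
      (\<Sum>k\<in>UNIV. if k = fst p then (if fst p = snd p then 1 else 0) else 0)"
    unfolding sum_component by (intro sum.cong) (auto simp: tensor_vec_def axis_def)
  then show ?thesis by simp
qed

lemma max_entangled_nth:
  "(max_entangled :: complex ^ ('n::finite \<times> 'n)) $ p =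
     (if fst p = snd p then of_real (1 / sqrt (real CARD('n))) else 0)"
  unfolding max_entangled_def vector_scaleR_component diagonal_tensor_nth
  by (simp add: scaleR_conv_of_real)

lemma norm_max_entangled: "norm (max_entangled :: complex ^ ('n::finite \<times> 'n)) = 1"
proof (rule norm_eq_1_if_cinner)
  have "cinner (max_entangled :: complex ^ ('n \<times> 'n)) max_entangled =
      (\<Sum>(i, j)\<in>UNIV \<times> (UNIV :: 'n set). if j = i then of_real ((1 / sqrt (real CARD('n)))\<^sup>2) else 0)"
    unfolding cinner_def max_entangled_nth
    by (simp only: UNIV_Times_UNIV) (intro sum.cong, auto simp: power2_eq_square simp flip: of_real_mult)
  also have "\<dots> = (\<Sum>i\<in>(UNIV :: 'n set). of_real ((1 / sqrt (real CARD('n)))\<^sup>2))"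
    unfolding sum.cartesian_product[symmetric] by simp
  also have "\<dots> = 1"
    by (simp add: power_divide)
  finally show "cinner (max_entangled :: complex ^ ('n \<times> 'n)) max_entangled = 1" .
qed

text \<open>Projecting the second factor of \<open>tensor_vec (axis k 1) (axis k 1)\<close> onto
  \<open>c a\<close> leaves the coefficient \<open>cnj (c a $ k)\<close>; summing over
  \<open>k\<close> collects these coefficients into \<open>conj_vec (c a)\<close> on Alice's
  side.\<close>

lemma king_proj_max_entangled:
  fixes c :: "'n \<Rightarrow> complex ^ 'n::finite"
  shows "king_proj c a *v max_entangled =
    (1 / sqrt (real CARD('n))) *\<^sub>R tensor_vec (conj_vec (c a)) (c a)"
proof -
  have "(king_proj c a *v max_entangled) $ p =
      ((1 / sqrt (real CARD('n))) *\<^sub>R tensor_vec (conj_vec (c a)) (c a)) $ p" for p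
  proof -
    obtain i j where p: "p = (i, j)" by fastforce
    let ?r = "of_real (1 / sqrt (real CARD('n))) :: complex"
    \<comment> \<open>The identity on Alice's side forces \<open>k = i\<close>, and the diagonal
      support of the state forces \<open>l = k\<close>, so one term survives.\<close>
    have "(king_proj c a *v max_entangled) $ p =
      (\<Sum>(k, l)\<in>UNIV \<times> UNIV. if l = k then (if k = i then c a $ j * cnj (c a $ l) * ?r else 0) else 0)"
      unfolding p matrix_vector_mult_def king_proj_def tensor_mat_def proj_vec_def max_entangled_nth
        mat_def
      by (simp only: UNIV_Times_UNIV vec_lambda_beta)
        (intro sum.cong, auto)
    also have "\<dots> = c a $ j * cnj (c a $ i) * ?r"
      unfolding sum.cartesian_product[symmetric] by simp
    finally show ?thesis
      unfolding p vector_scaleR_component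
      by (simp add: tensor_vec_def conj_vec_def scaleR_conv_of_real)
  qed
  then show ?thesis by (simp add: vec_eq_iff)
qed

lemma
  fixes c :: "'n \<Rightarrow> complex ^ 'n::finite"
  assumes "cinner (c a) (c a) = 1"
  shows born_prob_king_proj_max_entangled:
      "born_prob (king_proj c a) max_entangled = 1 / real CARD('n)"
    and post_state_king_proj_max_entangled:
      "post_state (king_proj c a) max_entangled = tensor_vec (conj_vec (c a)) (c a)"
proof -
  let ?r = "1 / sqrt (real CARD('n))" and ?\<phi> = "tensor_vec (conj_vec (c a)) (c a)"
  have r: "?r > 0" by simp
  have "cinner max_entangled (king_proj c a *v max_entangled) =
      of_real (?r * ?r) * cinner (c a) (c a)"
    unfolding king_proj_max_entangled
    unfolding max_entangled_def cinner_scaleR_left cinner_scaleR_right cinner_diagonal_conj_tensor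
    by (simp only: of_real_mult mult.assoc)
  then show "born_prob (king_proj c a) max_entangled = 1 / real CARD('n)"
    using assms by (simp add: born_prob_def flip: of_real_mult)
  have "norm ?\<phi> = 1"
    by (rule norm_eq_1_if_cinner) (simp add: cinner_conj_tensor assms)
  \<comment> \<open>The scalar is positive, so normalising removes it and the zero-vector default of
    \<open>post_state\<close> does not arise.\<close>
  then show "post_state (king_proj c a) max_entangled = ?\<phi>"
    using r by (simp add: post_state_def king_proj_max_entangled)
qed

lemma cinner_mu_vec:
  fixes b :: "nat \<Rightarrow> 'n \<Rightarrow> complex ^ 'n::finite"
  assumes mub: "mutually_unbiased_bases {0..CARD('n)} b" and x: "x \<in> {0..CARD('n)}"
  shows "cinner (mu_vec b f) (tensor_vec (conj_vec (b x a)) (b x a)) =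
    of_real (1 / sqrt (real CARD('n))) * (if f x = a then 1 else 0)"
proof -
  let ?\<phi> = "\<lambda>y k. tensor_vec (conj_vec (b y k)) (b y k)"
  have orth: "cinner (b x k) (b x l) = (if k = l then 1 else 0)" for k l
    using mub x by (simp add: mutually_unbiased_bases_def orthonormal_basis_def)
  have "(\<Sum>y\<in>{0..CARD('n)} - {x}. cinner (?\<phi> y (f y)) (?\<phi> x a)) =
      (\<Sum>y\<in>{0..CARD('n)} - {x}. of_real (1 / real CARD('n)))"
    using mub x unfolding cinner_conj_tensor
    by (intro sum.cong refl arg_cong[where f = of_real]) (auto simp: mutually_unbiased_bases_def)
  also have "\<dots> = 1"
    using x by simp
  finally have "(\<Sum>y = 0..CARD('n). cinner (?\<phi> y (f y)) (?\<phi> x a)) = cinner (?\<phi> x (f x)) (?\<phi> x a) + 1"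
    using x by (simp add: sum.remove)
  then show ?thesis
    \<comment> \<open>Only the sum over the bases is split; the diagonal sum must stay whole for
      \<open>cinner_diagonal_conj_tensor\<close>.\<close>
    unfolding mu_vec_def cinner_scaleR_left cinner_diff_left cinner_sum_left[of _ "{0..CARD('n)}"]
      cinner_diagonal_conj_tensor
    by (simp add: cinner_conj_tensor orth)
qed

theorem theorem37:
  fixes b :: "nat \<Rightarrow> 'n \<Rightarrow> complex ^ 'n::finite"
    and f :: "nat \<Rightarrow> nat \<Rightarrow> 'n"
  assumes "mutually_unbiased_bases {0..CARD('n)} b"
    and "orthonormal_basis {1..CARD('n)\<^sup>2} (\<lambda>i. mu_vec b (f i))"
  shows "mean_king_scheme {0..CARD('n)} b max_entangled {1..CARD('n)\<^sup>2}
           (\<lambda>i. proj_vec (mu_vec b (f i))) (\<lambda>i x. f i x) \<and>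
         solves_mean_king {0..CARD('n)} b max_entangled {1..CARD('n)\<^sup>2}
           (\<lambda>i. proj_vec (mu_vec b (f i))) (\<lambda>i x. f i x)"
proof
  let ?I = "{1..CARD('n)\<^sup>2}" and ?E = "\<lambda>i. proj_vec (mu_vec b (f i))"
  let ?n = "real CARD('n)"
  show "mean_king_scheme {0..CARD('n)} b max_entangled ?I ?E (\<lambda>i x. f i x)"
    using assms quantum_measurement_orthonormal_basis[OF assms(2)]
    by (simp add: mean_king_scheme_def norm_max_entangled)
  show "solves_mean_king {0..CARD('n)} b max_entangled ?I ?E (\<lambda>i x. f i x)"
    unfolding solves_mean_king_def
  proof (intro ballI conjI)
    fix x assume x: "x \<in> {0..CARD('n)}"
    \<comment> \<open>The joint density: one factor \<open>1 / ?n\<close> from the King's uniform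
      outcome, another from Alice's squared amplitude when her guess is right.\<close>
    define p where "p = (\<lambda>(a, i). if f i x = a then 1 / ?n\<^sup>2 else 0)"
    have unit: "cinner (b x a) (b x a) = 1" for a
      using assms(1) x by (simp add: mutually_unbiased_bases_def orthonormal_basis_def)
    have exp: "mean_king_experiment max_entangled (b x) ?I ?E =
        point_measure (UNIV \<times> ?I) (\<lambda>q. ennreal (p q))"
      unfolding mean_king_experiment_def p_def
      by (intro arg_cong2[where f = point_measure] ext)
        (auto simp: born_prob_king_proj_max_entangled[of "b x", OF unit]
          post_state_king_proj_max_entangled[of "b x", OF unit]
          born_prob_proj_vec cinner_mu_vec[OF assms(1) x] norm_divide power_divide power2_eq_square)
    \<comment> \<open>With \<open>i\<close> outermost, each inner sum has exactly one nonzero term,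
      at \<open>a = f i x\<close>, and there are \<open>?n\<^sup>2\<close> indices
      \<open>i\<close>.\<close>
    have "(\<Sum>q\<in>UNIV \<times> ?I. p q) = (\<Sum>i\<in>?I. \<Sum>a\<in>UNIV. p (a, i))"
      unfolding sum.cartesian_product' by (rule sum.swap)
    also have "\<dots> = 1"
      by (simp add: p_def)
    finally have "(\<Sum>q\<in>UNIV \<times> ?I. ennreal (p q)) = 1"
      by (subst sum_ennreal) (auto simp: p_def)
    then show "prob_space (mean_king_experiment max_entangled (b x) ?I ?E)"
      unfolding exp
      by (intro prob_spaceI) (simp add: space_point_measure emeasure_point_measure_finite)
    \<comment> \<open>For a point measure only points of positive density matter, and
      \<open>p\<close> vanishes wherever the guess is wrong.\<close>
    show "AE (a, i) in mean_king_experiment max_entangled (b x) ?I ?E. f i x = a"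
      unfolding exp by (auto simp: AE_point_measure p_def)
  qed
qed

end
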